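(* Fix $M\in\mathbb N$. Let $\{(x^k,n^k)\}$ be generated by the proximal block coordinate descent algorithm (see context) applied with $P(\cdot;M)=Q(\cdot;M)=F_M$. Suppose that $\{n^k\}$ converges to $n_M^*$, and let $x_M^*$ be a stability point given by the local stability condition. Moreover, assume that $F_M(x_M^*,\cdot)$ satisfies a local quadratic growth at $n_M^*$ on $\mathcal N$. Then, with probability $1$, $(x^k,n^k)$ converges to $(x_M^*,n_M^* )$, and $(x_M^*,n_M^* )$ is a local minimum of $F_M$ over $\mathcal X\times\mathcal N$.
   Context: $\mathcal I,\mathcal J$ are finite index sets, $b>0$, $\mathcal X=\{x\in\{0,1\}^{|\mathcal I|}:\sum_{i\in\mathcal I} x_i\le p\}$, $\mathcal N=[0,b]^{|\mathcal J|}$. The sample average approximation objective is $$F_M(x,n)=e+d^\top n+r^\top x+\frac1M\sum_{t=1}^M\sum_{j\in\mathcal J}h_j(n_j;\sigma_j)\sum_{i\in\mathcal I}q_{ij}\left(\zeta^t+\frac{g_{ij}(x)}{h_j(n_j;\sigma_j)}\right)_+,$$ where $(a)_+=\max\{0,a\}$, $\zeta^1,\dots,\zeta^M$ are i.i.d. realizations from $N(0,1)$, $e\in\mathbb R$, $d\in\mathbb R^{|\mathcal J|}$ (sampling costs), $r\in\mathbb R^{|\mathcal I|}$, $q_{ij}>0$, and each $g_{ij}$ is an affine function of $x$. The functions $h_j$ satisfy: (i) $h_j(\cdot;\sigma_j)$ is finite, positive, strictly convex, decreasing and continuously differentiable on $[0,\infty)$ for any $\sigma_j$; (ii) $\frac{\partial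 h_j}{\partial\sigma_j}(n_j;\sigma_j)>0$ for all $n_j\ge0$; (iii) $\frac{\partial^2h_j}{\partial n_j\partial\sigma_j}(n_j;\sigma_j)<0$ for all $n_j\ge0$. Algorithm: given $n^0\in\mathcal N$ and parameters $\lambda_k>0$, for $k=0,1,2,\dots$: - $x$-step: $x^{k+1}=T_M(n^k)\in\arg\min_{x\in\mathcal X}P(x,n^k;M)$, where ties are broken lexicographically ($x^1$ is preferred to $x^2$ if there is an index $i^*$ with $x^1_{i^*}=1$, $x^2_{i^*}=0$ and $x^1_i=x^2_i$ for all $i<i^*$), so that $T_M:\mathcal N\to\mathcal X$ is single-valued; - $n$-step: $n^{k+1}\in\arg\min_{n\in\mathcal N}\{Q(x^{k+1},n;M)+\frac{\lambda_k}{2}\|n-n^k\|^2\}$. Local stability condition: if $\{n^k\}$ converges to $\bar n$, then there exist $\bar x\in\mathcal X$ (a stability point) and a sufficiently large $K$ such that $\bar x=T_M(n^k)\in\arg\min_{x\in\mathcal X}P(x,n^k;M)$ for all $k>K$. Local quadratic growth of $G$ at $\bar n$ on $\mathcal N$: there exist $\varepsilon>0$ and $c>0$ with $G(n)\ge G(\bar n)+\frac c2\|n-\bar n\|^2$ for all $n\in\mathcal N$ with $\|n-\bar n\|<\varepsilon$. A point $(x^*,n^* )\in\mathcal X\times\mathcal N$ is a (blockwise) local minimum of $F_M$ if $x^*\in\arg\min_{x\in\mathcal X}F_M(x,n^* )$ and there is $\epsilon>0$ with $F_M(x^*,n^* )\le F_M(x^*,n)$ for all $n\in\mathcal N$ with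 $\|n-n^*\|<\epsilon$. *)

theory Defs
  imports "HOL-Probability.Probability"
begin

definition binary_set :: "real \<Rightarrow> (real ^ 'i) set" where
  "binary_set p = {x. (\<forall>i. x $ i \<in> {0, 1}) \<and> (\<Sum>i\<in>UNIV. x $ i) \<le> p}"

definition box_set :: "real \<Rightarrow> (real ^ 'j) set" where
  "box_set b = {n. \<forall>j. 0 \<le> n $ j \<and> n $ j \<le> b}"

definition affine_fun :: "(real ^ 'i \<Rightarrow> real) \<Rightarrow> bool" where
  "affine_fun f \<longleftrightarrow> (\<exists>a c. \<forall>x. f x = a \<bullet> x + c)"

definition strictly_convex_on :: "real set \<Rightarrow> (real \<Rightarrow> real) \<Rightarrow> bool" where
  "strictly_convex_on S f \<longleftrightarrow>
     (\<forall>x\<in>S. \<forall>y\<in>S. \<forall>u. x \<noteq> y \<and> 0 < u \<and> u < 1 \<longrightarrow>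
        f ((1 - u) * x + u * y) < (1 - u) * f x + u * f y)"

text \<open>The value \<open>h n s\<close> is the function at the allocation \<open>n \<ge> 0\<close> and the parameter \<open>s\<close>, and
  \<open>S\<close> is the open set of admissible parameters, e.g. \<open>{0<..}\<close> or \<open>UNIV\<close>. Derivatives with
  respect to \<open>n\<close> are one-sided at \<open>n = 0\<close>. In the last clause the derivative with respect to \<open>s\<close>
  is taken first.\<close>

definition error_function :: "real set \<Rightarrow> (real \<Rightarrow> real \<Rightarrow> real) \<Rightarrow> bool" where
  "error_function S h \<longleftrightarrow> open S \<and>
     (\<forall>s\<in>S.
        (\<forall>n\<ge>0. 0 < h n s) \<and>
        strictly_convex_on {0..} (\<lambda>n. h n s) \<and>
        antimono_on {0..} (\<lambda>n. h n s) \<and>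
        (\<exists>h'. (\<forall>n\<ge>0. ((\<lambda>m. h m s) has_real_derivative h' n) (at n within {0..})) \<and>
              continuous_on {0..} h') \<and>
        (\<forall>n\<ge>0. (\<lambda>t. h n t) differentiable (at s) \<and> deriv (\<lambda>t. h n t) s > 0) \<and>
        (\<forall>n\<ge>0. \<exists>D<0.
           ((\<lambda>m. deriv (\<lambda>t. h m t) s) has_real_derivative D) (at n within {0..})))"

definition saa_objective ::
  "nat \<Rightarrow> real \<Rightarrow> real ^ 'j::finite \<Rightarrow> real ^ 'i::finite \<Rightarrow>
   ('i::finite \<Rightarrow> 'j::finite \<Rightarrow> real) \<Rightarrow> ('i::finite \<Rightarrow> 'j::finite \<Rightarrow> real ^ 'i::finite \<Rightarrow> real) \<Rightarrow>
   ('j::finite \<Rightarrow> real \<Rightarrow> real \<Rightarrow> real) \<Rightarrow> ('j::finite \<Rightarrow> real) \<Rightarrow> (nat \<Rightarrow> real) \<Rightarrow>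
   real ^ 'i::finite \<Rightarrow> real ^ 'j::finite \<Rightarrow> real" where
  "saa_objective M e d r q g h \<sigma> \<zeta> x n =
     e + d \<bullet> n + r \<bullet> x +
     1 / real M * (\<Sum>t=1..M. \<Sum>j\<in>UNIV. h j (n $ j) (\<sigma> j) *
        (\<Sum>i\<in>UNIV. q i j * max 0 (\<zeta> t + g i j x / h j (n $ j) (\<sigma> j))))"

definition argmin_on :: "('a \<Rightarrow> real) \<Rightarrow> 'a set \<Rightarrow> 'a set" where
  "argmin_on f S = {x. is_arg_min f (\<lambda>y. y \<in> S) x}"

definition lex_preferred ::
  "real ^ 'i::{finite,linorder} \<Rightarrow> real ^ 'i::{finite,linorder} \<Rightarrow> bool" where
  "lex_preferred x y \<longleftrightarrow> (\<exists>i. x $ i = 1 \<and> y $ i = 0 \<and> (\<forall>i'<i. x $ i' = y $ i'))"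

definition lex_argmin ::
  "(real ^ 'i::{finite,linorder} \<Rightarrow> real) \<Rightarrow> (real ^ 'i::{finite,linorder}) set \<Rightarrow>
   real ^ 'i::{finite,linorder}" where
  "lex_argmin f S =
     (THE x. x \<in> argmin_on f S \<and> (\<forall>y\<in>argmin_on f S. y \<noteq> x \<longrightarrow> lex_preferred x y))"

definition x_step ::
  "(real ^ 'i::{finite,linorder}) set \<Rightarrow> (real ^ 'i::{finite,linorder} \<Rightarrow> real ^ 'j \<Rightarrow> real) \<Rightarrow>
   real ^ 'j \<Rightarrow> real ^ 'i::{finite,linorder}" where
  "x_step X P n = lex_argmin (\<lambda>x. P x n) X"

text \<open>Only the iterates \<open>xs k\<close> with \<open>k \<ge> 1\<close> are produced by the method; \<open>xs 0\<close> is arbitrary.\<close>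

definition proximal_bcd ::
  "(real ^ 'i::{finite,linorder}) set \<Rightarrow> (real ^ 'j) set \<Rightarrow>
   (real ^ 'i::{finite,linorder} \<Rightarrow> real ^ 'j \<Rightarrow> real) \<Rightarrow>
   (real ^ 'i::{finite,linorder} \<Rightarrow> real ^ 'j \<Rightarrow> real) \<Rightarrow>
   (nat \<Rightarrow> real) \<Rightarrow> real ^ 'j \<Rightarrow> (nat \<Rightarrow> real ^ 'i::{finite,linorder}) \<Rightarrow> (nat \<Rightarrow> real ^ 'j) \<Rightarrow> bool" where
  "proximal_bcd X N P Q lam n0 xs ns \<longleftrightarrow>
     ns 0 = n0 \<and>
     (\<forall>k. xs (Suc k) = x_step X P (ns k) \<and>
          xs (Suc k) \<in> argmin_on (\<lambda>x. P x (ns k)) X \<and>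
          ns (Suc k) \<in> argmin_on (\<lambda>n. Q (xs (Suc k)) n + lam k / 2 * (norm (n - ns k))\<^sup>2) N)"

definition stability_point ::
  "(real ^ 'i::{finite,linorder}) set \<Rightarrow> (real ^ 'i::{finite,linorder} \<Rightarrow> real ^ 'j \<Rightarrow> real) \<Rightarrow>
   (nat \<Rightarrow> real ^ 'j) \<Rightarrow> real ^ 'i::{finite,linorder} \<Rightarrow> bool" where
  "stability_point X P ns xbar \<longleftrightarrow>
     xbar \<in> X \<and>
     (\<exists>K. \<forall>k>K. xbar = x_step X P (ns k) \<and> xbar \<in> argmin_on (\<lambda>x. P x (ns k)) X)"

definition local_quadratic_growth ::
  "(real ^ 'j \<Rightarrow> real) \<Rightarrow> real ^ 'j \<Rightarrow> (real ^ 'j) set \<Rightarrow> bool" where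
  "local_quadratic_growth G nbar N \<longleftrightarrow>
     (\<exists>\<epsilon>>0. \<exists>c>0. \<forall>n\<in>N. norm (n - nbar) < \<epsilon> \<longrightarrow> G n \<ge> G nbar + c / 2 * (norm (n - nbar))\<^sup>2)"

definition blockwise_local_minimum ::
  "(real ^ 'i) set \<Rightarrow> (real ^ 'j) set \<Rightarrow> (real ^ 'i \<Rightarrow> real ^ 'j \<Rightarrow> real) \<Rightarrow>
   (real ^ 'i) \<times> (real ^ 'j) \<Rightarrow> bool" where
  "blockwise_local_minimum X N F = (\<lambda>(xstar, nstar).
     (xstar, nstar) \<in> X \<times> N \<and>
     xstar \<in> argmin_on (\<lambda>x. F x nstar) X \<and>
     (\<exists>\<epsilon>>0. \<forall>n\<in>N. norm (n - nstar) < \<epsilon> \<longrightarrow> F xstar nstar \<le> F xstar n))"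

lemma finite_binary_set: "finite (binary_set p :: (real ^ 'i) set)"
proof (rule finite_subset)
  show "binary_set p \<subseteq> (\<lambda>A. \<chi> i. if i \<in> A then 1 else 0) ` (UNIV :: 'i set set)"
  proof
    fix x :: "real ^ 'i" assume "x \<in> binary_set p"
    then have "\<And>i. x $ i = 0 \<or> x $ i = 1" by (auto simp: binary_set_def)
    then have "x = (\<chi> i. if i \<in> {i. x $ i = 1} then 1 else 0)"
      by (auto simp: vec_eq_iff)
    then show "x \<in> (\<lambda>A. \<chi> i. if i \<in> A then 1 else 0) ` (UNIV :: 'i set set)"
      by blast
  qed
qed simp

lemma lex_preferred_total:
  fixes x y :: "real ^ 'i::{finite,linorder}"
  assumes "x \<in> binary_set p" "y \<in> binary_set p" "x \<noteq> y"
  shows "lex_preferred x y \<or> lex_preferred y x"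
proof -
  define k where "k = Min {i. x $ i \<noteq> y $ i}"
  have "{i. x $ i \<noteq> y $ i} \<noteq> {}" using assms(3) by (auto simp: vec_eq_iff)
  then have "k \<in> {i. x $ i \<noteq> y $ i}" unfolding k_def by (intro Min_in) auto
  moreover have eq: "x $ i = y $ i" if "i < k" for i
  proof (rule ccontr)
    assume "x $ i \<noteq> y $ i"
    then have "k \<le> i" unfolding k_def by (intro Min_le) auto
    then show False using that by simp
  qed
  moreover have "x $ k = 0 \<or> x $ k = 1" "y $ k = 0 \<or> y $ k = 1"
    using assms(1,2) by (auto simp: binary_set_def)
  ultimately have "x $ k = 1 \<and> y $ k = 0 \<or> y $ k = 1 \<and> x $ k = 0" by auto
  then show ?thesis
  proof
    assume "x $ k = 1 \<and> y $ k = 0"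
    then have "lex_preferred x y" unfolding lex_preferred_def using eq by blast
    then show ?thesis ..
  next
    assume "y $ k = 1 \<and> x $ k = 0"
    then have "lex_preferred y x" unfolding lex_preferred_def using eq by (metis (no_types))
    then show ?thesis ..
  qed
qed

lemma lex_preferred_trans:
  assumes "lex_preferred x y" "lex_preferred y z"
  shows "lex_preferred x z"
proof -
  obtain i where i: "x $ i = 1" "y $ i = 0" "\<And>i'. i' < i \<Longrightarrow> x $ i' = y $ i'"
    using assms(1) by (auto simp: lex_preferred_def)
  obtain k where k: "y $ k = 1" "z $ k = 0" "\<And>i'. i' < k \<Longrightarrow> y $ i' = z $ i'"
    using assms(2) by (auto simp: lex_preferred_def)
  show ?thesis
  proof (cases i k rule: linorder_cases)
    case less
    then show ?thesis using i k unfolding lex_preferred_def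
      by (intro exI[of _ i]) (auto dest: less_trans)
  next
    case equal
    then show ?thesis using i k by simp
  next
    case greater
    then show ?thesis using i k unfolding lex_preferred_def
      by (intro exI[of _ k]) (auto dest: less_trans)
  qed
qed

lemma lex_preferred_asym: "lex_preferred x y \<Longrightarrow> \<not> lex_preferred y x"
proof
  assume "lex_preferred x y" "lex_preferred y x"
  then have "lex_preferred x x" by (rule lex_preferred_trans)
  then show False unfolding lex_preferred_def by auto
qed

lemma x_step_in_argmin:
  fixes P :: "real ^ 'i::{finite,linorder} \<Rightarrow> real ^ 'j \<Rightarrow> real"
  assumes "0 \<le> p"
  shows "x_step (binary_set p) P n \<in> argmin_on (\<lambda>x. P x n) (binary_set p)"
proof -
  let ?A = "argmin_on (\<lambda>x. P x n) (binary_set p)"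
  have sub: "?A \<subseteq> binary_set p" by (auto simp: argmin_on_def is_arg_min_def)
  then have fin: "finite ?A" using finite_binary_set finite_subset by blast
  have "0 \<in> (binary_set p :: (real ^ 'i::{finite,linorder}) set)" using assms by (simp add: binary_set_def)
  then have "?A \<noteq> {}"
    using ex_is_arg_min_if_finite[OF finite_binary_set, of p "\<lambda>x. P x n"]
    by (auto simp: argmin_on_def)
  have "B \<subseteq> binary_set p \<Longrightarrow> \<exists>x\<in>B. \<forall>y\<in>B. y \<noteq> x \<longrightarrow> lex_preferred x y"
    if "finite B" "B \<noteq> {}" for B :: "(real ^ 'i::{finite,linorder}) set"
    using that
  proof (induction B rule: finite_ne_induct)
    case (singleton x)
    then show ?case by simp
  next
    case (insert z B)
    then obtain x where x: "x \<in> B" "\<forall>y\<in>B. y \<noteq> x \<longrightarrow> lex_preferred x y" by auto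
    have "z \<noteq> x" using insert x by auto
    then consider "lex_preferred x z" | "lex_preferred z x"
      using lex_preferred_total[of x p z] insert.prems x by auto
    then show ?case
    proof cases
      case 1
      then show ?thesis using x by (intro bexI[of _ x]) auto
    next
      case 2
      have "lex_preferred z y" if "y \<in> B" for y
      proof (cases "y = x")
        case False
        then have "lex_preferred x y" using x(2) that by simp
        with 2 show ?thesis by (rule lex_preferred_trans)
      qed (simp add: 2)
      then show ?thesis by (intro bexI[of _ z]) auto
    qed
  qed
  from this[OF fin \<open>?A \<noteq> {}\<close> sub]
  obtain x where x: "x \<in> ?A" "\<forall>y\<in>?A. y \<noteq> x \<longrightarrow> lex_preferred x y" by (elim bexE)
  have "x_step (binary_set p) P n = x"
    unfolding x_step_def lex_argmin_def
  proof (rule the_equality)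
    show "x \<in> ?A \<and> (\<forall>y\<in>?A. y \<noteq> x \<longrightarrow> lex_preferred x y)"
      by (intro conjI x)
  next
    fix z assume z: "z \<in> ?A \<and> (\<forall>y\<in>?A. y \<noteq> z \<longrightarrow> lex_preferred z y)"
    show "z = x"
    proof (rule ccontr)
      assume "z \<noteq> x"
      then have "lex_preferred x z" "lex_preferred z x"
        using x(2)[rule_format, of z] x(1) z by metis+
      then show False using lex_preferred_asym by metis
    qed
  qed
  then show ?thesis using x(1) by (rule ssubst)
qed

end

theory Submission
  imports Defs
begin

text \<open>The argument is pathwise: it works for each outcome \<open>\<omega>\<close>, that is, for each realization
  of the sample.

  The \<open>x\<close>-block is the only one in which the limit is not under direct control, because the
  solution map \<open>x_step\<close> takes values in a finite set and jumps. Local stability removes this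
  problem: the \<open>x\<close>-iterates are eventually constant and equal to the stability point. This one
  point minimizes \<open>F \<cdot> (ns k)\<close> over \<open>X\<close> for all large \<open>k\<close>, and each of the inequalities
  \<open>F xbar (ns k) \<le> F y (ns k)\<close> survives the limit \<open>k \<rightarrow> \<infinity>\<close> as soon as \<open>F y\<close> is continuous
  on the box (\<open>argmin_on_limit\<close>). Continuity is where the structure of \<open>F\<close> enters: \<open>F\<close> divides by
  \<open>h\<^sub>j(n\<^sub>j; \<sigma>\<^sub>j)\<close>, which is continuous and never zero on the box (\<open>continuous_on_saa_objective\<close>).
  The limit of the \<open>n\<close>-iterates lies in the box because the box is closed. In the \<open>n\<close>-block, the
  limit is a local minimizer because quadratic growth is a strengthening of local minimality.\<close>

lemma closed_box_set: "closed (box_set b)"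
proof -
  have "box_set b = {n. \<forall>j. 0 \<le> n $ j} \<inter> {n. \<forall>j. n $ j \<le> b}"
    by (auto simp: box_set_def)
  also have "closed \<dots>"
    by (intro closed_Int closed_Collect_all closed_Collect_le continuous_intros)
  finally show ?thesis .
qed

lemma error_function_pos: "error_function S h \<Longrightarrow> s \<in> S \<Longrightarrow> 0 \<le> n \<Longrightarrow> 0 < h n s"
  by (simp add: error_function_def)

lemma continuous_on_error_function:
  assumes "error_function S h" "s \<in> S"
  shows "continuous_on {0..} (\<lambda>n. h n s)"
proof -
  obtain h' where "\<forall>n\<ge>0. ((\<lambda>m. h m s) has_real_derivative h' n) (at n within {0..})"
    using assms unfolding error_function_def by blast
  then show ?thesis
    by (intro DERIV_continuous_on) auto
qed

text \<open>Positivity of \<open>h\<close> keeps the quotients \<open>g i j x / h j (n $ j) (\<sigma> j)\<close> continuous in \<open>n\<close>; the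
  positive part is continuous although it is not smooth.\<close>

lemma continuous_on_saa_objective:
  fixes g :: "'i::finite \<Rightarrow> 'j::finite \<Rightarrow> real ^ 'i \<Rightarrow> real"
  assumes h: "\<And>j. error_function (S j) (h j)" and \<sigma>: "\<And>j. \<sigma> j \<in> S j"
  shows "continuous_on (box_set b) (saa_objective M e d r q g h \<sigma> \<zeta> x)"
proof -
  have cont: "continuous_on (box_set b) (\<lambda>n. h j (n $ j) (\<sigma> j))" for j
    by (rule continuous_on_compose2[OF continuous_on_error_function[OF h \<sigma>]])
       (auto simp: box_set_def intro!: continuous_intros)
  have nz: "\<forall>n\<in>box_set b. h j (n $ j) (\<sigma> j) \<noteq> 0" for j
  proof
    fix n :: "real ^ 'j" assume "n \<in> box_set b"
    then have "0 < h j (n $ j) (\<sigma> j)"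
      by (intro error_function_pos[OF h \<sigma>]) (simp add: box_set_def)
    then show "h j (n $ j) (\<sigma> j) \<noteq> 0" by simp
  qed
  show ?thesis
    unfolding saa_objective_def
    by (intro continuous_intros cont nz)
qed

text \<open>Weak inequalities pass to the limit, so pointwise convergence on \<open>X\<close> is enough when the
  minimizer is the same point for all large \<open>k\<close>.\<close>

lemma argmin_on_limit:
  assumes "\<forall>\<^sub>F k in sequentially. x \<in> argmin_on (f k) X"
    and "\<And>y. y \<in> X \<Longrightarrow> (\<lambda>k. f k y) \<longlonglongrightarrow> f' y"
  shows "x \<in> argmin_on f' X"
proof -
  have x: "x \<in> X"
    using eventually_happens[OF assms(1)] by (auto simp: argmin_on_def is_arg_min_def)
  have "f' x \<le> f' y" if "y \<in> X" for y
  proof (rule tendsto_le[OF sequentially_bot assms(2)[OF that] assms(2)[OF x]])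
    show "\<forall>\<^sub>F k in sequentially. f k x \<le> f k y"
      using assms(1) by eventually_elim
        (use that in \<open>auto simp: argmin_on_def is_arg_min_linorder\<close>)
  qed
  then show ?thesis
    using x by (simp add: argmin_on_def is_arg_min_linorder)
qed

lemma local_quadratic_growth_imp_local_min:
  assumes "local_quadratic_growth G nbar N"
  shows "\<exists>\<epsilon>>0. \<forall>n\<in>N. norm (n - nbar) < \<epsilon> \<longrightarrow> G nbar \<le> G n"
proof -
  obtain \<epsilon> c where pos: "\<epsilon> > 0" "c > 0"
    and growth: "\<And>n. n \<in> N \<Longrightarrow> norm (n - nbar) < \<epsilon> \<Longrightarrow>
      G nbar + c / 2 * (norm (n - nbar))\<^sup>2 \<le> G n"
    using assms unfolding local_quadratic_growth_def by blast
  have "G nbar \<le> G n" if "n \<in> N" "norm (n - nbar) < \<epsilon>" for n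
  proof -
    have "0 \<le> c / 2 * (norm (n - nbar))\<^sup>2" using pos by simp
    with growth[OF that] show ?thesis by linarith
  qed
  then show ?thesis using pos by blast
qed

text \<open>Stability freezes the \<open>x\<close>-block after finitely many steps, so its convergence is trivial.\<close>

lemma proximal_bcd_stability_tendsto:
  assumes "proximal_bcd X N P Q lam n0 xs ns" "stability_point X P ns xbar"
  shows "xs \<longlonglongrightarrow> xbar"
proof (rule tendsto_eventually)
  obtain K where K: "\<And>k. k > K \<Longrightarrow> xbar = x_step X P (ns k)"
    using assms(2) unfolding stability_point_def by blast
  \<comment> \<open>The \<open>x\<close>-iterate with index \<open>Suc k\<close> is computed from \<open>ns k\<close>, hence the shift by one.\<close>
  have "\<forall>k>K. xs (Suc k) = xbar"
    using assms(1) K unfolding proximal_bcd_def by metis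
  then have "\<forall>\<^sub>F k in sequentially. xs (Suc k) = xbar"
    by (intro eventually_sequentiallyI[of "Suc K"]) simp
  then show "\<forall>\<^sub>F k in sequentially. xs k = xbar"
    by (rule eventually_sequentially_Suc[THEN iffD1])
qed

lemma proximal_bcd_iterate_in: "proximal_bcd X N P Q lam n0 xs ns \<Longrightarrow> ns (Suc k) \<in> N"
  by (auto simp: proximal_bcd_def argmin_on_def is_arg_min_def)

text \<open>The two blocks need different reasons. For \<open>x\<close>, optimality at the iterates is carried to the
  limit by continuity in \<open>n\<close>; for \<open>n\<close>, optimality comes from quadratic growth.\<close>

lemma proximal_bcd_blockwise_local_minimum:
  assumes alg: "proximal_bcd X N F F lam n0 xs ns" and lim: "ns \<longlonglongrightarrow> nbar"
    and stab: "stability_point X F ns xbar"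
    and growth: "local_quadratic_growth (F xbar) nbar N"
    and "closed N" and cont: "\<And>x. x \<in> X \<Longrightarrow> continuous_on N (F x)"
  shows "blockwise_local_minimum X N F (xbar, nbar)"
proof -
  \<comment> \<open>Every \<open>ns (Suc k)\<close> is the result of an \<open>n\<close>-step and so lies in \<open>N\<close>; the shift by one, here
    and below, skips the initial point, for which this need not hold.\<close>
  note in_N = proximal_bcd_iterate_in[OF alg]
  have nbar: "nbar \<in> N"
    using \<open>closed N\<close> in_N LIMSEQ_Suc[OF lim] by (rule closed_sequentially)
  have "xbar \<in> argmin_on (\<lambda>x. F x nbar) X"
  proof (rule argmin_on_limit[where f = "\<lambda>k x. F x (ns (Suc k))"])
    obtain K where "\<And>k. k > K \<Longrightarrow> xbar \<in> argmin_on (\<lambda>x. F x (ns k)) X"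
      using stab unfolding stability_point_def by blast
    then show "\<forall>\<^sub>F k in sequentially. xbar \<in> argmin_on (\<lambda>x. F x (ns (Suc k))) X"
      by (intro eventually_sequentiallyI[of K]) simp
  next
    fix y assume "y \<in> X"
    show "(\<lambda>k. F y (ns (Suc k))) \<longlonglongrightarrow> F y nbar"
      by (intro continuous_on_tendsto_compose[OF cont[OF \<open>y \<in> X\<close>] LIMSEQ_Suc[OF lim] nbar])
        (simp add: in_N)
  qed
  moreover have "xbar \<in> X" using stab by (simp add: stability_point_def)
  ultimately show ?thesis
    using nbar local_quadratic_growth_imp_local_min[OF growth]
    by (simp add: blockwise_local_minimum_def)
qed

theorem theorem4:
  fixes W :: "'w measure" and Z :: "nat \<Rightarrow> 'w \<Rightarrow> real"
    and M :: nat and p b e :: real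
    and d :: "real ^ 'j::finite" and r :: "real ^ 'i::{finite,linorder}"
    and q :: "'i::{finite,linorder} \<Rightarrow> 'j::finite \<Rightarrow> real" and g :: "'i::{finite,linorder} \<Rightarrow> 'j::finite \<Rightarrow> real ^ 'i::{finite,linorder} \<Rightarrow> real"
    and S :: "'j::finite \<Rightarrow> real set" and h :: "'j::finite \<Rightarrow> real \<Rightarrow> real \<Rightarrow> real" and \<sigma> :: "'j::finite \<Rightarrow> real"
    and lam :: "nat \<Rightarrow> real" and n0 :: "real ^ 'j::finite"
    and xs :: "'w \<Rightarrow> nat \<Rightarrow> real ^ 'i::{finite,linorder}" and ns :: "'w \<Rightarrow> nat \<Rightarrow> real ^ 'j::finite"
    and xstar :: "'w \<Rightarrow> real ^ 'i::{finite,linorder}" and nstar :: "'w \<Rightarrow> real ^ 'j::finite"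
  defines "X \<equiv> binary_set p" and "N \<equiv> box_set b"
    and "F \<equiv> (\<lambda>\<omega>. saa_objective M e d r q g h \<sigma> (\<lambda>t. Z t \<omega>))"
  assumes "prob_space W"
    and "prob_space.indep_vars W (\<lambda>_. borel) Z {1..M}"
    and "\<And>t. t \<in> {1..M} \<Longrightarrow> distributed W lborel (Z t) std_normal_density"
    and "M \<ge> 1" and "b > 0"
    and "\<And>i j. q i j > 0"
    and "\<And>i j. affine_fun (g i j)"
    and "\<And>j. error_function (S j) (h j)" and "\<And>j. \<sigma> j \<in> S j"
    and "n0 \<in> N" and "\<And>k. lam k > 0"
  shows "AE \<omega> in W.
     proximal_bcd X N (F \<omega>) (F \<omega>) lam n0 (xs \<omega>) (ns \<omega>) \<longrightarrow>
     ns \<omega> \<longlonglongrightarrow> nstar \<omega> \<longrightarrow>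
     stability_point X (F \<omega>) (ns \<omega>) (xstar \<omega>) \<longrightarrow>
     local_quadratic_growth (F \<omega> (xstar \<omega>)) (nstar \<omega>) N \<longrightarrow>
     (\<lambda>k. (xs \<omega> k, ns \<omega> k)) \<longlonglongrightarrow> (xstar \<omega>, nstar \<omega>) \<and>
     blockwise_local_minimum X N (F \<omega>) (xstar \<omega>, nstar \<omega>)"
proof (intro AE_I2 impI conjI)
  fix \<omega>
  assume alg: "proximal_bcd X N (F \<omega>) (F \<omega>) lam n0 (xs \<omega>) (ns \<omega>)"
    and lim: "ns \<omega> \<longlonglongrightarrow> nstar \<omega>"
    and stab: "stability_point X (F \<omega>) (ns \<omega>) (xstar \<omega>)"
    and growth: "local_quadratic_growth (F \<omega> (xstar \<omega>)) (nstar \<omega>) N"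
  show "(\<lambda>k. (xs \<omega> k, ns \<omega> k)) \<longlonglongrightarrow> (xstar \<omega>, nstar \<omega>)"
    by (intro tendsto_Pair proximal_bcd_stability_tendsto[OF alg stab] lim)
  have "closed N" unfolding N_def by (rule closed_box_set)
  moreover have "continuous_on N (F \<omega> x)" for x
    unfolding N_def F_def by (rule continuous_on_saa_objective) fact+
  ultimately show "blockwise_local_minimum X N (F \<omega>) (xstar \<omega>, nstar \<omega>)"
    by (intro proximal_bcd_blockwise_local_minimum[OF alg lim stab growth])
qed

end
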